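(* Let $1\le k\le n$ and let $f:\mathbb{F}_2^n\to\mathbb{F}_2$ be a function of algebraic degree exactly $k$. Then \[\prod_{i=1}^{k}\Big(1-\frac{1}{2^i}\Big)\le\mathrm{dt}_k(f)\le\frac12\Big(1-\frac{1}{2^n}\Big)^{k-1}.\] Moreover, the lower bound is attained if and only if $f\sim_{k-1}x_1\cdots x_k$.
   Context: $\oplus$ denotes addition in $\mathbb{F}_2$ and $\mathbb{F}_2^n$. The algebraic degree $\deg(f)$ of $f:\mathbb{F}_2^n\to\mathbb{F}_2$ is the degree of its algebraic normal form (the unique polynomial over $\mathbb{F}_2$ of degree at most one in each variable representing $f$). For $1\le k\le n$, \[\mathrm{dt}_k(f)=\frac{\big|\{(u_0,\dots,u_k)\in(\mathbb{F}_2^n)^{k+1}:\ \bigoplus_{c_1,\dots,c_k\in\mathbb{F}_2} f\big((\bigoplus_{i=1}^k c_iu_i)\oplus u_0\big)\neq0\}\big|}{2^{(k+1)n}}.\] For $M\in GL(n,\mathbb{F}_2)$, $v\in\mathbb{F}_2^n$, $\varphi_{M,v}(x)=Mx\oplus v$; $f\sim g$ means $g=f\circ\varphi_{M,v}$ for some such $M,v$; and $f\sim_{k-1}g$ means there is $h$ with $f\sim h$ and $\deg(g\oplus h)\le k-1$. *)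

theory Defs
  imports Complex_Main "HOL-Library.Z2" "HOL-Library.FuncSet"
begin

text \<open>F_2 is the type bit. Vectors of F_2^n are functions nat => bit vanishing
  outside {0..<n} (coordinate i+1 of the paper is index i here).
  Boolean functions are f :: (nat => bit) => bit, only their values on Vn n matter.\<close>

definition Vn :: "nat \<Rightarrow> (nat \<Rightarrow> bit) set" where
  "Vn n = {x. \<forall>i\<ge>n. x i = 0}"

definition vadd :: "(nat \<Rightarrow> bit) \<Rightarrow> (nat \<Rightarrow> bit) \<Rightarrow> (nat \<Rightarrow> bit)" where
  "vadd x y = (\<lambda>i. x i + y i)"

definition is_anf :: "nat \<Rightarrow> (nat set \<Rightarrow> bit) \<Rightarrow> ((nat \<Rightarrow> bit) \<Rightarrow> bit) \<Rightarrow> bool" where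
  "is_anf n a f \<longleftrightarrow> (\<forall>S. \<not> S \<subseteq> {..<n} \<longrightarrow> a S = 0) \<and>
     (\<forall>x\<in>Vn n. f x = (\<Sum>S\<in>Pow {..<n}. a S * (\<Prod>i\<in>S. x i)))"

definition anf :: "nat \<Rightarrow> ((nat \<Rightarrow> bit) \<Rightarrow> bit) \<Rightarrow> (nat set \<Rightarrow> bit)" where
  "anf n f = (THE a. is_anf n a f)"

text \<open>Algebraic degree (the zero function gets degree 0).\<close>
definition deg :: "nat \<Rightarrow> ((nat \<Rightarrow> bit) \<Rightarrow> bit) \<Rightarrow> nat" where
  "deg n f = Max ({card S | S. S \<subseteq> {..<n} \<and> anf n f S \<noteq> 0} \<union> {0})"

definition kder :: "nat \<Rightarrow> ((nat \<Rightarrow> bit) \<Rightarrow> bit) \<Rightarrow> (nat \<Rightarrow> nat \<Rightarrow> bit) \<Rightarrow> bit" where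
  "kder k f u = (\<Sum>c\<in>PiE {1..k} (\<lambda>_. UNIV :: bit set).
       f (\<lambda>j. (\<Sum>i\<in>{1..k}. c i * u i j) + u 0 j))"

definition dt :: "nat \<Rightarrow> nat \<Rightarrow> ((nat \<Rightarrow> bit) \<Rightarrow> bit) \<Rightarrow> real" where
  "dt n k f = real (card {u \<in> PiE {0..k} (\<lambda>_. Vn n). kder k f u \<noteq> 0}) / 2 ^ ((k + 1) * n)"

text \<open>n x n matrices over F_2 as nat => nat => bit (only entries below n matter).\<close>
definition mat_mult :: "nat \<Rightarrow> (nat \<Rightarrow> nat \<Rightarrow> bit) \<Rightarrow> (nat \<Rightarrow> nat \<Rightarrow> bit) \<Rightarrow> (nat \<Rightarrow> nat \<Rightarrow> bit)" where
  "mat_mult n A B = (\<lambda>i j. \<Sum>l<n. A i l * B l j)"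

definition GL :: "nat \<Rightarrow> (nat \<Rightarrow> nat \<Rightarrow> bit) \<Rightarrow> bool" where
  "GL n M \<longleftrightarrow> (\<exists>N. \<forall>i<n. \<forall>j<n.
      mat_mult n M N i j = (if i = j then 1 else 0) \<and> mat_mult n N M i j = (if i = j then 1 else 0))"

definition affmap :: "nat \<Rightarrow> (nat \<Rightarrow> nat \<Rightarrow> bit) \<Rightarrow> (nat \<Rightarrow> bit) \<Rightarrow> (nat \<Rightarrow> bit) \<Rightarrow> (nat \<Rightarrow> bit)" where
  "affmap n M v x = (\<lambda>j. if j < n then (\<Sum>i<n. M j i * x i) + v j else 0)"

definition affeq :: "nat \<Rightarrow> ((nat \<Rightarrow> bit) \<Rightarrow> bit) \<Rightarrow> ((nat \<Rightarrow> bit) \<Rightarrow> bit) \<Rightarrow> bool" where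
  "affeq n f g \<longleftrightarrow> (\<exists>M v. GL n M \<and> v \<in> Vn n \<and> (\<forall>x\<in>Vn n. g x = f (affmap n M v x)))"

definition affeq_deg :: "nat \<Rightarrow> nat \<Rightarrow> ((nat \<Rightarrow> bit) \<Rightarrow> bit) \<Rightarrow> ((nat \<Rightarrow> bit) \<Rightarrow> bit) \<Rightarrow> bool" where
  "affeq_deg n d f g \<longleftrightarrow> (\<exists>h. affeq n f h \<and> deg n (\<lambda>x. g x + h x) \<le> d)"

end

theory Submission
  imports Defs "HOL-Library.Function_Algebras"
begin

text \<open>
  If \<open>f\<close> has degree \<open>k\<close>, its \<open>k\<close>-fold derivative does not depend on the base point and is a
  nonzero alternating \<open>k\<close>-linear form in the directions. Let \<open>R\<close> be the radical of this form, i.e.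
  the directions \<open>u\<close> for which the derivative of \<open>f\<close> along \<open>u\<close> has degree less than \<open>k - 1\<close>.
  For \<open>u\<close> outside \<open>R\<close> the radical of the derivative along \<open>u\<close> contains \<open>R\<close> and \<open>u\<close>, hence is at
  least twice as large; by induction \<open>R\<close> has codimension at least \<open>k\<close>. Averaging over the first
  direction, which must avoid \<open>R\<close>, gives the lower bound, with equality iff the codimension is
  exactly \<open>k\<close>. In that case a basis of \<open>R\<close> extended to the whole space is a coordinate system in
  which \<open>f\<close> has a single monomial of degree \<open>k\<close>. The upper bound only uses that no direction may
  be zero and that a linear functional is nonzero on at most half of the space.
\<close>

\<comment> \<open>These rules replace the field operations by xor/and and so block ring reasoning.\<close>
declare add_bit_eq_xor [simp del] mult_bit_eq_and [simp del]

section \<open>Arithmetic in characteristic two and the vectors of \<open>Vn\<close>\<close>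

lemma bit_add_self [simp]: "x + x = 0" for x :: bit
  by (cases x) simp_all

lemma bit_add_self_left [simp]: "x + (x + y) = y" for x y :: bit
  by (simp flip: add.assoc)

lemma bit_add_eq_0_iff [simp]: "x + y = 0 \<longleftrightarrow> x = y" for x y :: bit
  by (cases x; cases y) simp_all

lemma bitfun_add_self [simp]: "x + x = 0" for x :: "'a \<Rightarrow> bit"
  by (simp add: fun_eq_iff)

lemma bitfun_add_self_left [simp]: "x + (x + y) = y" for x y :: "'a \<Rightarrow> bit"
  by (simp flip: add.assoc)

lemma bitfun_add_eq_0_iff [simp]: "x + y = 0 \<longleftrightarrow> x = y" for x y :: "'a \<Rightarrow> bit"
  by (simp add: fun_eq_iff)

lemma sum_fun_apply: "(\<Sum>i\<in>I. b i) j = (\<Sum>i\<in>I. b i j)" for b :: "'a \<Rightarrow> 'b \<Rightarrow> 'c::comm_monoid_add"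
  by (induction I rule: infinite_finite_induct) simp_all

text \<open>Subsets of the coordinates become points, so a Boolean function is a function on a
  subset lattice.\<close>

definition ind :: "nat set \<Rightarrow> nat \<Rightarrow> bit" where
  "ind S = (\<lambda>i. of_bool (i \<in> S))"

lemma Vn_0 [simp]: "0 \<in> Vn n"
  by (simp add: Vn_def)

lemma Vn_add [simp]: "x \<in> Vn n \<Longrightarrow> y \<in> Vn n \<Longrightarrow> x + y \<in> Vn n"
  by (simp add: Vn_def)

lemma ind_in_Vn [simp]: "ind S \<in> Vn n \<longleftrightarrow> S \<subseteq> {..<n}"
  by (auto simp: Vn_def ind_def) (meson leI)

lemma Vn_eq_ind: "x \<in> Vn n \<Longrightarrow> x = ind {i. i < n \<and> x i = 1}"
  by (auto simp: Vn_def ind_def fun_eq_iff simp flip: bit_not_one_iff)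

lemma inj_ind: "inj_on ind A"
  by (auto simp: inj_on_def ind_def fun_eq_iff of_bool_eq_iff)

lemma bij_betw_ind: "bij_betw ind (Pow {..<n}) (Vn n)"
  unfolding bij_betw_def
proof (intro conjI inj_ind equalityI subsetI)
  fix x assume "x \<in> Vn n"
  then show "x \<in> ind ` Pow {..<n}"
    using Vn_eq_ind[of x n] by (intro image_eqI[of x ind "{i. i < n \<and> x i = 1}"]) auto
qed auto

lemma finite_Vn [simp]: "finite (Vn n)"
  using bij_betw_finite[OF bij_betw_ind] by blast

lemma card_Vn: "card (Vn n) = 2 ^ n"
  using bij_betw_same_card[OF bij_betw_ind, of n] by (simp add: card_Pow)

subsection \<open>Derivatives and degree\<close>

definition der :: "(nat \<Rightarrow> bit) \<Rightarrow> ((nat \<Rightarrow> bit) \<Rightarrow> bit) \<Rightarrow> (nat \<Rightarrow> bit) \<Rightarrow> bit" where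
  "der u f = (\<lambda>x. f (x + u) + f x)"

lemma der_commute: "der u (der v f) = der v (der u f)"
  by (simp add: der_def fun_eq_iff add_ac)

lemma der_add_fun: "der u (f + g) = der u f + der u g"
  by (simp add: der_def fun_eq_iff add_ac)

text \<open>The correction term is a second derivative: modulo lower degree, the derivative is
  additive in its direction.\<close>

lemma der_add: "der (u + v) f = der u f + der v f + der u (der v f)"
  by (simp add: der_def fun_eq_iff add_ac)

lemma der_self [simp]: "der u (der u f) = 0"
  by (simp add: der_def fun_eq_iff add_ac)

lemma der_0 [simp]: "der 0 f = 0" "der u 0 = 0"
  by (simp_all add: der_def fun_eq_iff)

text \<open>Degree smaller than \<open>d\<close>, expressed by the vanishing of all \<open>d\<close>-fold derivatives; thus
  \<open>deg_lt n 0\<close> singles out the zero function. Agreement with \<^const>\<open>deg\<close> is \<open>deg_le_iff_deg_lt\<close>.\<close>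
fun deg_lt :: "nat \<Rightarrow> nat \<Rightarrow> ((nat \<Rightarrow> bit) \<Rightarrow> bit) \<Rightarrow> bool" where
  "deg_lt n 0 f \<longleftrightarrow> (\<forall>x\<in>Vn n. f x = 0)"
| "deg_lt n (Suc d) f \<longleftrightarrow> (\<forall>u\<in>Vn n. deg_lt n d (der u f))"

lemma deg_lt_cong: "(\<And>x. x \<in> Vn n \<Longrightarrow> f x = g x) \<Longrightarrow> deg_lt n d f \<longleftrightarrow> deg_lt n d g"
proof (induction d arbitrary: f g)
  case (Suc d)
  have "deg_lt n d (der u f) \<longleftrightarrow> deg_lt n d (der u g)" if "u \<in> Vn n" for u
  proof (rule Suc.IH)
    fix x assume "x \<in> Vn n"
    with that show "der u f x = der u g x"
      by (simp only: der_def Suc.prems Vn_add)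
  qed
  then show ?case by simp
qed simp

lemma deg_lt_0 [simp]: "deg_lt n d 0"
proof (induction d)
  case (Suc d)
  then show ?case unfolding deg_lt.simps der_0 by blast
qed simp

lemma deg_lt_add: "deg_lt n d f \<Longrightarrow> deg_lt n d g \<Longrightarrow> deg_lt n d (f + g)"
  by (induction d arbitrary: f g) (simp_all add: der_add_fun)

lemma deg_lt_sum: "(\<And>i. i \<in> I \<Longrightarrow> deg_lt n d (g i)) \<Longrightarrow> deg_lt n d (\<Sum>i\<in>I. g i)"
  by (induction I rule: infinite_finite_induct) (simp_all add: deg_lt_add)

lemma deg_lt_Suc: "deg_lt n d f \<Longrightarrow> deg_lt n (Suc d) f"
proof (induction d arbitrary: f)
  case 0
  then show ?case by (simp add: der_def)
next
  case (Suc d)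
  then show ?case by (metis deg_lt.simps(2))
qed

lemma deg_lt_mono: "deg_lt n d f \<Longrightarrow> d \<le> e \<Longrightarrow> deg_lt n e f"
  by (rule dec_induct[of d e "\<lambda>e. deg_lt n e f"]) (simp_all only: deg_lt_Suc)

lemma deg_lt_der: "deg_lt n d f \<Longrightarrow> u \<in> Vn n \<Longrightarrow> deg_lt n (d - 1) (der u f)"
  using deg_lt_Suc[of n d f] by (cases d) simp_all

lemma deg_lt_1_constant: "deg_lt n 1 f \<Longrightarrow> x \<in> Vn n \<Longrightarrow> f x = f 0"
proof -
  assume "deg_lt n 1 f" "x \<in> Vn n"
  then have "der x f 0 = 0" by simp
  then show ?thesis by (simp add: der_def)
qed

lemma deg_lt_1_eq_1:
  assumes "deg_lt n 1 f" "\<not> deg_lt n 0 f" "x \<in> Vn n"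
  shows "f x = 1"
proof -
  obtain y where "y \<in> Vn n" "f y \<noteq> 0"
    using assms by auto
  then show ?thesis
    using deg_lt_1_constant[OF assms(1), of x] deg_lt_1_constant[OF assms(1), of y] assms(3) by simp
qed

text \<open>By the Leibniz rule \<open>der u (x i * g x) = x i * der u g x + u i * g (x + u)\<close>.\<close>
lemma deg_lt_coordinate_mult:
  "deg_lt n d g \<Longrightarrow> deg_lt n (Suc d) (\<lambda>x. x i * g x)"
proof (induction d arbitrary: g)
  case 0
  then show ?case by (simp add: der_def)
next
  case (Suc d)
  have "deg_lt n (Suc d) (der u (\<lambda>x. x i * g x))" if u: "u \<in> Vn n" for u
  proof -
    have "der u (\<lambda>x. x i * g x)
        = (\<lambda>x. x i * der u g x) + (if u i = 0 then 0 else der u g + g)"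
      by (cases "u i") (auto simp: der_def fun_eq_iff algebra_simps)
    moreover have "deg_lt n (Suc d) (der u g + g)"
      using Suc.prems u deg_lt_Suc[of n d "der u g"] by (intro deg_lt_add) auto
    moreover have "deg_lt n (Suc d) (\<lambda>x. x i * der u g x)"
      using Suc.prems u by (intro Suc.IH) simp
    ultimately show ?thesis
      by (simp only: deg_lt_add deg_lt_0 split: if_split) blast
  qed
  then show ?case by (subst deg_lt.simps(2)) blast
qed

lemma deg_lt_monomial: "finite S \<Longrightarrow> deg_lt n (Suc (card S)) (\<lambda>x. \<Prod>i\<in>S. x i)"
proof (induction S rule: finite_induct)
  case empty
  then show ?case by (simp add: der_def)
next
  case (insert i S)
  then show ?case
    using deg_lt_coordinate_mult[of n "Suc (card S)" "\<lambda>x. \<Prod>i\<in>S. x i" i]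
    by (simp del: deg_lt.simps)
qed

subsection \<open>Algebraic normal form\<close>

text \<open>The coefficient of the monomial \<open>S\<close> in the algebraic normal form, by Moebius inversion.\<close>
definition moebius :: "((nat \<Rightarrow> bit) \<Rightarrow> bit) \<Rightarrow> nat set \<Rightarrow> bit" where
  "moebius f S = (\<Sum>T\<in>Pow S. f (ind T))"

text \<open>Since -1 = 1 the signs disappear and the transform is its own inverse; it turns values
  into coefficients and back.\<close>

lemma bit_moebius_inversion:
  fixes f g :: "'a set \<Rightarrow> bit"
  assumes "\<And>S. finite S \<Longrightarrow> g S = sum f (Pow S)" and "finite S"
  shows "f S = sum g (Pow S)"
  using inclusion_exclusion_mobius[of g f S] assms by simp

lemma prod_ind: "finite S \<Longrightarrow> (\<Prod>i\<in>S. ind T i) = of_bool (S \<subseteq> T)"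
  by (induction S rule: finite_induct) (auto simp: ind_def)

lemma anf_sum_at_ind:
  assumes "T \<subseteq> {..<n}"
  shows "(\<Sum>S\<in>Pow {..<n}. a S * (\<Prod>i\<in>S. ind T i)) = (\<Sum>S\<in>Pow T. a S)"
proof -
  have "(\<Sum>S\<in>Pow {..<n}. a S * (\<Prod>i\<in>S. ind T i)) = (\<Sum>S\<in>Pow {..<n}. if S \<in> Pow T then a S else 0)"
    by (intro sum.cong refl) (auto simp: prod_ind finite_subset)
  also have "\<dots> = (\<Sum>S\<in>Pow {..<n} \<inter> Pow T. a S)"
    by (subst sum.inter_restrict) auto
  also have "Pow {..<n} \<inter> Pow T = Pow T"
    using assms by auto
  finally show ?thesis .
qed

lemma anf_unique:
  assumes "is_anf n a f"
  shows "a S = (if S \<subseteq> {..<n} then moebius f S else 0)"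
proof (cases "S \<subseteq> {..<n}")
  case True
  have *: "f (ind T) = sum a (Pow T)" if "T \<subseteq> {..<n}" for T
    using assms that anf_sum_at_ind[OF that, of a] by (auto simp: is_anf_def)
  have "a S = (\<Sum>T\<in>Pow S. sum a (Pow T))"
    by (rule bit_moebius_inversion) (use True finite_subset in auto)
  also have "\<dots> = moebius f S"
    unfolding moebius_def using True by (intro sum.cong refl) (auto simp: *)
  finally show ?thesis using True by simp
qed (use assms in \<open>auto simp: is_anf_def\<close>)

lemma is_anf_moebius: "is_anf n (\<lambda>S. if S \<subseteq> {..<n} then moebius f S else 0) f"
  unfolding is_anf_def
proof (intro conjI ballI allI impI)
  fix x assume x: "x \<in> Vn n"
  define T where "T = {i. i < n \<and> x i = 1}"
  have xT: "x = ind T" and T: "T \<subseteq> {..<n}"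
    using Vn_eq_ind[OF x] by (auto simp: T_def)
  have "f (ind T) = sum (moebius f) (Pow T)"
    by (rule bit_moebius_inversion) (use T finite_subset in \<open>auto simp: moebius_def\<close>)
  also have "\<dots> = (\<Sum>S\<in>Pow T. if S \<subseteq> {..<n} then moebius f S else 0)"
    using T by (intro sum.cong refl) auto
  finally show "f x = (\<Sum>S\<in>Pow {..<n}. (if S \<subseteq> {..<n} then moebius f S else 0) * (\<Prod>i\<in>S. x i))"
    unfolding xT anf_sum_at_ind[OF T] .
qed auto

lemma anf_eq_moebius: "S \<subseteq> {..<n} \<Longrightarrow> anf n f S = moebius f S"
proof -
  assume S: "S \<subseteq> {..<n}"
  have "anf n f = (\<lambda>S. if S \<subseteq> {..<n} then moebius f S else 0)"
    unfolding anf_def using is_anf_moebius anf_unique by (intro the_equality ext)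
  with S show ?thesis by simp
qed

lemma deg_le_iff_moebius:
  "deg n f \<le> d \<longleftrightarrow> (\<forall>S\<subseteq>{..<n}. d < card S \<longrightarrow> moebius f S = 0)"
proof -
  have "finite {card S | S. S \<subseteq> {..<n} \<and> anf n f S \<noteq> 0}"
    by (rule finite_subset[of _ "card ` Pow {..<n}"]) auto
  then have "deg n f \<le> d \<longleftrightarrow> (\<forall>S. S \<subseteq> {..<n} \<and> anf n f S \<noteq> 0 \<longrightarrow> card S \<le> d)"
    unfolding deg_def by (subst Max_le_iff) auto
  also have "\<dots> \<longleftrightarrow> (\<forall>S\<subseteq>{..<n}. d < card S \<longrightarrow> moebius f S = 0)"
    by (metis anf_eq_moebius linorder_not_le)
  finally show ?thesis .
qed

text \<open>Subsets of \<open>insert i S\<close> come in pairs \<open>T\<close>,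
  \<open>insert i T\<close>; the two values of \<open>f\<close> add up to one value of the
  derivative.\<close>

lemma moebius_insert:
  assumes "finite S" "i \<notin> S"
  shows "moebius f (insert i S) = moebius (der (ind {i}) f) S"
proof -
  have "(\<Sum>T\<in>insert i ` Pow S. f (ind T)) = (\<Sum>T\<in>Pow S. f (ind (insert i T)))"
    using assms by (subst sum.reindex) (auto simp: inj_on_def)
  also have "\<dots> = (\<Sum>T\<in>Pow S. f (ind T + ind {i}))"
    using assms by (intro sum.cong arg_cong[of _ _ f]) (auto simp: ind_def fun_eq_iff)
  finally have "moebius f (insert i S) = (\<Sum>T\<in>Pow S. f (ind T)) + (\<Sum>T\<in>Pow S. f (ind T + ind {i}))"
    unfolding moebius_def Pow_insert using assms by (subst sum.union_disjoint) auto
  then show ?thesis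
    by (simp add: moebius_def der_def sum.distrib add.commute)
qed

text \<open>Each derivative along a unit vector removes one index from \<open>S\<close>; after
  \<open>d\<close> of them the zero function is left.\<close>

lemma moebius_eq_0_if_deg_lt:
  "deg_lt n d f \<Longrightarrow> S \<subseteq> {..<n} \<Longrightarrow> d \<le> card S \<Longrightarrow> moebius f S = 0"
proof (induction d arbitrary: f S)
  case 0
  then show ?case by (auto simp: moebius_def intro!: sum.neutral)
next
  case (Suc d)
  then obtain i where i: "i \<in> S" by fastforce
  have fin: "finite S" using Suc.prems finite_subset by auto
  have "moebius f S = moebius (der (ind {i}) f) (S - {i})"
    using moebius_insert[of "S - {i}" i f] i fin by (simp add: insert_absorb)
  also have "\<dots> = 0"
    using Suc.prems i fin by (intro Suc.IH) auto
  finally show ?case .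
qed

lemma deg_le_iff_deg_lt: "deg n f \<le> d \<longleftrightarrow> deg_lt n (Suc d) f"
proof
  assume *: "deg n f \<le> d"
  define m where "m S = (\<lambda>x. moebius f S * (\<Prod>i\<in>S. x i))" for S
  have "f x = (\<Sum>S\<in>Pow {..<n}. m S) x" if "x \<in> Vn n" for x
  proof -
    have "f x = (\<Sum>S\<in>Pow {..<n}. (if S \<subseteq> {..<n} then moebius f S else 0) * (\<Prod>i\<in>S. x i))"
      using is_anf_moebius[of n f] that unfolding is_anf_def by blast
    also have "\<dots> = (\<Sum>S\<in>Pow {..<n}. m S x)"
      by (intro sum.cong) (auto simp: m_def)
    finally show ?thesis by (simp add: sum_fun_apply)
  qed
  moreover have "deg_lt n (Suc d) (\<Sum>S\<in>Pow {..<n}. m S)"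
  proof (rule deg_lt_sum)
    fix S assume "S \<in> Pow {..<n}"
    then have S: "S \<subseteq> {..<n}" "finite S" by (auto intro: finite_subset)
    show "deg_lt n (Suc d) (m S)"
    proof (cases "moebius f S = 0")
      case True
      then have "m S = 0" by (simp add: m_def fun_eq_iff)
      then show ?thesis by simp
    next
      case False
      then have "card S \<le> d"
        using * S by (metis deg_le_iff_moebius not_le)
      moreover have "m S = (\<lambda>x. \<Prod>i\<in>S. x i)"
        using False by (simp add: m_def)
      ultimately show ?thesis
        using deg_lt_mono[OF deg_lt_monomial[OF S(2), of n]] by (simp del: deg_lt.simps)
    qed
  qed
  ultimately show "deg_lt n (Suc d) f"
    using deg_lt_cong by blast
next
  assume "deg_lt n (Suc d) f"
  then show "deg n f \<le> d"
    unfolding deg_le_iff_moebius by (blast intro: moebius_eq_0_if_deg_lt Suc_leI)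
qed

subsection \<open>The radical\<close>

text \<open>For \<open>f\<close> of degree \<open>k\<close> this is the radical of the alternating form given by the
  \<open>k\<close>-fold derivative. For \<open>k = 0\<close> truncated subtraction makes it all of \<open>Vn n\<close> when \<open>f\<close> is
  constant, which is the correct base case of the inductions.\<close>
definition radical :: "nat \<Rightarrow> nat \<Rightarrow> ((nat \<Rightarrow> bit) \<Rightarrow> bit) \<Rightarrow> (nat \<Rightarrow> bit) set" where
  "radical n k f = {u \<in> Vn n. deg_lt n (k - 1) (der u f)}"

lemma radical_subset: "radical n k f \<subseteq> Vn n"
  by (auto simp: radical_def)

lemma finite_radical [simp]: "finite (radical n k f)"
  using radical_subset finite_Vn by (rule finite_subset)

text \<open>The mixed derivative in \<open>der_add\<close> obeys the same degree bound as
  \<open>der v f\<close>.\<close>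

lemma add_in_radical:
  assumes "u \<in> radical n k f" "v \<in> radical n k f"
  shows "u + v \<in> radical n k f"
proof -
  have "deg_lt n (k - 1) (der u (der v f))"
    using assms deg_lt_der[of n "k - 1" "der v f" u] deg_lt_mono[of n "k - 1 - 1" _ "k - 1"]
    by (auto simp: radical_def)
  then show ?thesis
    using assms unfolding radical_def der_add mem_Collect_eq by (intro conjI deg_lt_add Vn_add) blast+
qed

text \<open>As the radical is closed under addition and misses \<open>u\<close>, it is disjoint from
  its translate by \<open>u\<close>. Both lie in the radical of the derivative, which contains
  \<open>u\<close> because deriving twice along \<open>u\<close> gives zero.\<close>

lemma card_radical_der:
  assumes u: "u \<in> Vn n" and nu: "u \<notin> radical n (Suc k) f"
  shows "2 * card (radical n (Suc k) f) \<le> card (radical n k (der u f))"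
proof -
  let ?R = "radical n (Suc k) f" and ?S = "radical n k (der u f)"
  have sub: "?R \<subseteq> ?S"
    using u deg_lt_der[of n k _ u] unfolding radical_def der_commute[of _ u] by auto
  have "u \<in> ?S"
    using u by (simp only: radical_def mem_Collect_eq der_self deg_lt_0)
  then have sub': "(+) u ` ?R \<subseteq> ?S"
    using sub add_in_radical by blast
  have "?R \<inter> (+) u ` ?R = {}"
  proof (rule ccontr)
    assume "?R \<inter> (+) u ` ?R \<noteq> {}"
    then obtain r where r: "r \<in> ?R" "u + r \<in> ?R" by blast
    have "(u + r) + r \<in> ?R" by (rule add_in_radical[OF r(2,1)])
    with nu show False by (simp add: add.assoc)
  qed
  then have "card (?R \<union> (+) u ` ?R) = 2 * card ?R"
    by (simp add: card_Un_disjoint card_image)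
  moreover have "card (?R \<union> (+) u ` ?R) \<le> card ?S"
    using sub sub' by (intro card_mono) auto
  ultimately show ?thesis by simp
qed

text \<open>Directions are chosen so that the iterated derivative stays nonzero. Each at least
  doubles the radical, which never exceeds the whole space.\<close>

lemma card_radical_le:
  "\<not> deg_lt n k f \<Longrightarrow> card (radical n k f) * 2 ^ k \<le> 2 ^ n"
proof (induction k arbitrary: f)
  case 0
  show ?case using card_mono[OF finite_Vn radical_subset, of n 0 f] by (simp add: card_Vn)
next
  case (Suc k)
  then obtain u where u: "u \<in> Vn n" "\<not> deg_lt n k (der u f)"
    by auto
  then have "2 * card (radical n (Suc k) f) \<le> card (radical n k (der u f))"
    by (intro card_radical_der) (auto simp: radical_def)
  then have "2 * card (radical n (Suc k) f) * 2 ^ k \<le> card (radical n k (der u f)) * 2 ^ k"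
    by (rule mult_right_mono) simp
  also note Suc.IH[OF u(2)]
  finally show ?case by (simp add: mult_ac)
qed

subsection \<open>The density of nonvanishing derivatives\<close>

text \<open>The fraction of points and directions at which the \<open>k\<close>-fold derivative does not vanish.\<close>
fun der_avg :: "nat \<Rightarrow> nat \<Rightarrow> ((nat \<Rightarrow> bit) \<Rightarrow> bit) \<Rightarrow> real" where
  "der_avg n 0 f = card {x \<in> Vn n. f x \<noteq> 0} / 2 ^ n"
| "der_avg n (Suc k) f = (\<Sum>u\<in>Vn n. der_avg n k (der u f)) / 2 ^ n"

lemma der_avg_eq_0: "deg_lt n k f \<Longrightarrow> der_avg n k f = 0"
proof (induction k arbitrary: f)
  case 0
  then have "{x \<in> Vn n. f x \<noteq> 0} = {}" by auto
  then show ?case by (simp only: der_avg.simps) simp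
qed (simp add: sum.neutral)

lemma der_avg_Suc:
  "der_avg n (Suc k) f = (\<Sum>u\<in>Vn n - radical n (Suc k) f. der_avg n k (der u f)) / 2 ^ n"
proof -
  have "(\<Sum>u\<in>Vn n. der_avg n k (der u f)) = (\<Sum>u\<in>Vn n - radical n (Suc k) f. der_avg n k (der u f))"
    by (intro sum.mono_neutral_right) (auto simp: radical_def der_avg_eq_0)
  then show ?thesis by simp
qed

lemma card_Vn_minus_radical: "real (card (Vn n - radical n k f)) = 2 ^ n - real (card (radical n k f))"
  using card_mono[OF finite_Vn radical_subset, of n k f]
  by (simp add: card_Diff_subset radical_subset card_Vn of_nat_diff)

lemma prod_one_minus_half_powers_pos: "0 < (\<Prod>i=1..k. 1 - 1 / (2::real) ^ i)"
proof (intro prod_pos ballI)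
  fix i assume "i \<in> {1..k}"
  then have "(2::real) ^ 0 < 2 ^ i" by (intro power_strict_increasing) auto
  then show "0 < 1 - 1 / (2::real) ^ i" by simp
qed

lemma der_avg_lower:
  assumes "deg_lt n (Suc k) f" "\<not> deg_lt n k f"
  shows "(\<Prod>i=1..k. 1 - 1 / (2::real) ^ i) \<le> der_avg n k f \<and>
    (der_avg n k f = (\<Prod>i=1..k. 1 - 1 / (2::real) ^ i) \<longleftrightarrow> card (radical n k f) * 2 ^ k = 2 ^ n)"
  using assms
proof (induction k arbitrary: f)
  case 0
  have "f x = 1" if "x \<in> Vn n" for x
    using 0 that deg_lt_1_eq_1[of n f x] by simp
  then have "{x \<in> Vn n. f x \<noteq> 0} = Vn n" by auto
  moreover have "radical n 0 f = Vn n"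
    using 0 by (auto simp: radical_def)
  ultimately show ?case by (simp only: der_avg.simps card_Vn) simp
next
  case (Suc k)
  define p where "p = (\<Prod>i=1..k. 1 - 1 / (2::real) ^ i)"
  define R where "R = radical n (Suc k) f"
  define s where "s = (\<Sum>u\<in>Vn n - R. der_avg n k (der u f))"
  have p: "p > 0"
    unfolding p_def by (rule prod_one_minus_half_powers_pos)
  have pSuc: "(\<Prod>i=1..Suc k. 1 - 1 / (2::real) ^ i) = p * (1 - 1 / 2 ^ Suc k)"
    by (simp add: p_def)
  have avg: "der_avg n (Suc k) f = s / 2 ^ n"
    by (simp only: der_avg_Suc s_def R_def)
  have le: "card R * 2 ^ Suc k \<le> 2 ^ n"
    unfolding R_def using Suc.prems by (intro card_radical_le)
  then have "real (card R * 2 ^ Suc k) \<le> real (2 ^ n)"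
    by (simp only: of_nat_le_iff)
  then have le_real: "real (card R) \<le> 2 ^ n / 2 ^ Suc k"
    by (simp add: field_simps)
  \<comment> \<open>Outside \<open>R\<close> the derivative has degree exactly \<open>k\<close>, so
    the induction hypothesis applies to it.\<close>
  have IH: "p \<le> der_avg n k (der u f)"
      "der_avg n k (der u f) = p \<longleftrightarrow> card (radical n k (der u f)) * 2 ^ k = 2 ^ n"
      "card (radical n k (der u f)) * 2 ^ k \<le> 2 ^ n"
      "2 * card R \<le> card (radical n k (der u f))"
    if "u \<in> Vn n - R" for u
    using that Suc.IH[of "der u f"] Suc.prems card_radical_le[of n k "der u f"] card_radical_der[of u n k f]
    by (auto simp: R_def radical_def p_def)
  have card: "real (card (Vn n - R)) = 2 ^ n - real (card R)"
    unfolding R_def by (rule card_Vn_minus_radical)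
  have scaled: "p * (1 - 1 / 2 ^ Suc k) = (2 ^ n - 2 ^ n / 2 ^ Suc k) * p / 2 ^ n"
    by (simp add: field_simps)
  have s_ge: "(2 ^ n - real (card R)) * p \<le> s"
    unfolding s_def card[symmetric] using IH(1) by (intro sum_bounded_below) auto
  have "(2 ^ n - 2 ^ n / 2 ^ Suc k) * p \<le> (2 ^ n - real (card R)) * p"
    using p le_real by (intro mult_right_mono) auto
  then have "(2 ^ n - 2 ^ n / 2 ^ Suc k) * p \<le> s"
    using s_ge by linarith
  then have lower: "p * (1 - 1 / 2 ^ Suc k) \<le> s / 2 ^ n"
    unfolding scaled by (intro divide_right_mono) auto
  \<comment> \<open>Since \<open>p\<close> is positive, equality bounds the cardinality of
    \<open>R\<close> from below; \<open>le_real\<close> is the bound from above.\<close>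
  have "card R * 2 ^ Suc k = 2 ^ n" if "s / 2 ^ n = p * (1 - 1 / 2 ^ Suc k)"
  proof -
    have "s = p * (2 ^ n - 2 ^ n / 2 ^ Suc k)"
      using that unfolding scaled by (simp add: mult.commute)
    with s_ge have "p * (2 ^ n - real (card R)) \<le> p * (2 ^ n - 2 ^ n / 2 ^ Suc k)"
      by (simp only: mult.commute)
    then have "2 ^ n / 2 ^ Suc k \<le> real (card R)"
      using p by simp
    with le_real have "real (card R) = 2 ^ n / 2 ^ Suc k" by linarith
    then have "real (card R * 2 ^ Suc k) = real (2 ^ n)" by simp
    then show ?thesis by (simp only: of_nat_eq_iff)
  qed
  moreover have "s / 2 ^ n = p * (1 - 1 / 2 ^ Suc k)" if *: "card R * 2 ^ Suc k = 2 ^ n"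
  proof -
    \<comment> \<open>Extremality is inherited: the radical of \<open>der u f\<close> has at least
      \<open>2 * card R\<close> elements, already the maximum possible.\<close>
    have "der_avg n k (der u f) = p" if u: "u \<in> Vn n - R" for u
    proof -
      have "2 ^ n = 2 * card R * 2 ^ k"
        using * by (simp add: mult_ac)
      also have "\<dots> \<le> card (radical n k (der u f)) * 2 ^ k"
        using IH(4)[OF u] by (rule mult_right_mono) simp
      finally show ?thesis using IH(2,3)[OF u] by simp
    qed
    then have "s = (2 ^ n - real (card R)) * p"
      unfolding s_def card[symmetric] by simp
    moreover have "real (card R) * 2 ^ Suc k = 2 ^ n"
      using arg_cong[OF *, of real] by simp
    then have "real (card R) = 2 ^ n / 2 ^ Suc k"
      by (simp add: field_simps)
    ultimately show ?thesis
      unfolding scaled by (simp only:)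
  qed
  ultimately show ?case
    unfolding pSuc avg R_def[symmetric] using lower by blast
qed

text \<open>Bounding the degree from above, rather than fixing it, lets the induction pass to every
  derivative. One direction gives the factor one half, each further one
  \<open>1 - 1 / 2 ^ n\<close>.\<close>

lemma der_avg_upper:
  "deg_lt n (Suc (Suc k)) f \<Longrightarrow> der_avg n (Suc k) f \<le> 1 / 2 * (1 - 1 / 2 ^ n) ^ k"
proof (induction k arbitrary: f)
  case 0
  define R where "R = radical n 1 f"
  have one: "der u f x = 1" if "u \<in> Vn n" "u \<notin> R" "x \<in> Vn n" for u x
    using 0 that deg_lt_1_eq_1[of n "der u f" x] by (simp add: R_def radical_def)
  have avg_le: "der_avg n 0 g \<le> 1" for g
    using card_mono[OF finite_Vn, of "{x \<in> Vn n. g x \<noteq> 0}" n] by (simp add: card_Vn del: bit_not_zero_iff)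
  have "card (Vn n - R) \<le> card R"
  proof (cases "Vn n - R = {}")
    case True
    then show ?thesis by (simp only: card.empty)
  next
    case False
    then obtain v where v: "v \<in> Vn n" "v \<notin> R" by blast
    have "(+) v ` (Vn n - R) \<subseteq> R"
    proof
      fix w assume "w \<in> (+) v ` (Vn n - R)"
      then obtain u where u: "u \<in> Vn n" "u \<notin> R" "w = v + u" by auto
      \<comment> \<open>Both derivatives are constantly 1, so the mixed one vanishes and the
        derivative along \<open>v + u\<close> is 1 + 1 + 0 = 0. Translation by \<open>v\<close> thus
        maps the complement of \<open>R\<close> into \<open>R\<close>.\<close>
      have "der v (der u f) x = 0" if "x \<in> Vn n" for x
        using that v u(1,2) by (simp add: der_def[of v] one)
      then have "der w f x = 0" if "x \<in> Vn n" for x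
        using that unfolding u(3) der_add plus_fun_apply by (simp only: one[OF v] one[OF u(1,2)]) simp
      then show "w \<in> R"
        using u(1) v(1) unfolding R_def radical_def u(3) by simp
    qed
    then have "card ((+) v ` (Vn n - R)) \<le> card R"
      by (intro card_mono) (auto simp: R_def)
    then show ?thesis by (simp add: card_image)
  qed
  then have "real (card (Vn n - R)) \<le> 2 ^ n / 2"
    using card_Vn_minus_radical[of n 1 f] by (simp add: R_def)
  moreover have "(\<Sum>u\<in>Vn n - R. der_avg n 0 (der u f)) \<le> real (card (Vn n - R)) * 1"
    using avg_le by (intro sum_bounded_above) simp
  ultimately have "(\<Sum>u\<in>Vn n - R. der_avg n 0 (der u f)) \<le> 2 ^ n / 2" by linarith
  then show ?case
    unfolding der_avg_Suc by (simp add: R_def field_simps)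
next
  case (Suc k)
  \<comment> \<open>The zero direction contributes nothing, which leaves \<open>2 ^ n - 1\<close>
    directions.\<close>
  have "(\<Sum>u\<in>Vn n. der_avg n (Suc k) (der u f)) = (\<Sum>u\<in>Vn n - {0}. der_avg n (Suc k) (der u f))"
    by (intro sum.mono_neutral_right ballI der_avg_eq_0) (auto simp only: der_0 deg_lt_0 finite_Vn)
  also have "\<dots> \<le> real (card (Vn n - {0})) * (1 / 2 * (1 - 1 / 2 ^ n) ^ k)"
    using Suc.prems by (intro sum_bounded_above Suc.IH) auto
  also have "real (card (Vn n - {0})) = 2 ^ n - 1"
    by (simp add: card_Vn of_nat_diff)
  finally show ?case
    by (simp add: field_simps)
qed

section \<open>Comparison with the definition of \<open>dt\<close>\<close>

text \<open>The last coefficient is 0 or 1, so the sum over the cube splits into two sums whose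
  points differ by \<open>w\<close>.\<close>

lemma kder_Suc: "kder (Suc k) f (u(Suc k := w)) = kder k (der w f) u"
proof -
  define P where "P = PiE {1..k} (\<lambda>_. UNIV :: bit set)"
  define b where "b c = (\<lambda>j. (\<Sum>i\<in>{1..k}. c i * u i j) + u 0 j)" for c
  have "kder (Suc k) f (u(Suc k := w)) = (\<Sum>(y, c)\<in>(UNIV :: bit set) \<times> P.
      f (\<lambda>j. (\<Sum>i\<in>{1..Suc k}. (c(Suc k := y)) i * (u(Suc k := w)) i j) + (u(Suc k := w)) 0 j))"
  proof -
    have "{1..Suc k} = insert (Suc k) {1..k}" by auto
    then have "PiE {1..Suc k} (\<lambda>_. UNIV :: bit set) = (\<lambda>(y, c). c(Suc k := y)) ` (UNIV \<times> P)"
      by (simp only: PiE_insert_eq P_def)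
    moreover have "inj_on (\<lambda>(y, c). c(Suc k := y)) ((UNIV :: bit set) \<times> P)"
      unfolding P_def by (rule inj_combinator) simp
    ultimately show ?thesis
      unfolding kder_def by (simp only: sum.reindex o_def) (simp only: case_prod_unfold)
  qed
  also have "\<dots> = (\<Sum>(y, c)\<in>(UNIV :: bit set) \<times> P. f (b c + (if y = 0 then 0 else w)))"
  proof -
    have "(\<lambda>j. (\<Sum>i\<in>{1..Suc k}. (c(Suc k := y)) i * (u(Suc k := w)) i j) + (u(Suc k := w)) 0 j)
        = b c + (if y = 0 then 0 else w)" for c and y :: bit
      by (cases y) (auto simp: b_def fun_eq_iff add_ac intro!: sum.cong)
    then show ?thesis by (simp only:)
  qed
  also have "\<dots> = (\<Sum>y\<in>{0, 1 :: bit}. \<Sum>c\<in>P. f (b c + (if y = 0 then 0 else w)))"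
    using bit.exhaust by (subst sum.cartesian_product) (auto intro!: sum.cong)
  also have "\<dots> = (\<Sum>c\<in>P. der w f (b c))"
    by (simp add: der_def sum.distrib add.commute)
  finally show ?thesis
    unfolding kder_def P_def b_def .
qed

text \<open>Removing the last direction turns a tuple into a vector and a shorter tuple;
  \<open>u 0\<close> remains as the base point.\<close>

lemma dt_eq_der_avg: "dt n k f = der_avg n k f"
proof (induction k arbitrary: f)
  case 0
  have "{u \<in> PiE {0..0} (\<lambda>_. Vn n). kder 0 f u \<noteq> 0}
      = (\<lambda>x. (\<lambda>_. undefined)(0 := x)) ` {x \<in> Vn n. f x \<noteq> 0}"
    by (auto simp: kder_def PiE_insert_eq simp del: bit_not_zero_iff)
  moreover have "inj_on (\<lambda>x. (\<lambda>_::nat. undefined)(0 := x)) {x \<in> Vn n. f x \<noteq> 0}"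
    by (auto simp: inj_on_def fun_upd_eqD dest: fun_upd_eqD)
  ultimately show ?case
    by (simp add: dt_def card_image)
next
  case (Suc k)
  let ?P = "PiE {0..k} (\<lambda>_. Vn n)"
  let ?A = "\<lambda>w. {u \<in> ?P. kder k (der w f) u \<noteq> 0}"
  have eq: "{0..Suc k} = insert (Suc k) {0..k}" by auto
  have fin: "finite ?P" by (intro finite_PiE) auto
  have "{u \<in> PiE {0..Suc k} (\<lambda>_. Vn n). kder (Suc k) f u \<noteq> 0}
      = (\<lambda>(w, u). u(Suc k := w)) ` (SIGMA w:Vn n. ?A w)"
    unfolding eq PiE_insert_eq
    by (auto simp: kder_Suc image_iff simp del: bit_not_zero_iff)
  moreover have "inj_on (\<lambda>(w, u). u(Suc k := w)) (SIGMA w:Vn n. ?A w)"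
    by (rule inj_on_subset[OF inj_combinator[of "Suc k" "{0..k}" "\<lambda>_. Vn n"]]) auto
  ultimately have "card {u \<in> PiE {0..Suc k} (\<lambda>_. Vn n). kder (Suc k) f u \<noteq> 0} = (\<Sum>w\<in>Vn n. card (?A w))"
    using fin by (simp add: card_image del: bit_not_zero_iff)
  then have "dt n (Suc k) f = (\<Sum>w\<in>Vn n. real (card (?A w))) / 2 ^ ((Suc k + 1) * n)"
    unfolding dt_def by simp
  also have "\<dots> = (\<Sum>w\<in>Vn n. dt n k (der w f)) / 2 ^ n"
    by (simp add: dt_def sum_divide_distrib power_add mult_ac)
  finally show ?case
    by (simp add: Suc.IH)
qed

subsection \<open>Affine equivalence\<close>

lemma affmap_in_Vn [simp]: "affmap n M v x \<in> Vn n"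
  by (simp add: affmap_def Vn_def)

text \<open>A shift of the argument is moved by the linear part alone, which is
  \<open>affmap\<close> with translation \<open>0\<close>.\<close>

lemma affmap_add_arg: "affmap n M v (x + y) = affmap n M v x + affmap n M 0 y"
  by (auto simp: affmap_def fun_eq_iff algebra_simps sum.distrib)

lemma affmap_compose: "affmap n A 0 (affmap n B 0 x) = affmap n (mat_mult n A B) 0 x"
proof
  fix j
  have "(\<Sum>i<n. A j i * (\<Sum>l<n. B i l * x l)) = (\<Sum>i<n. \<Sum>l<n. A j i * B i l * x l)"
    by (simp add: sum_distrib_left mult.assoc)
  also have "\<dots> = (\<Sum>l<n. \<Sum>i<n. A j i * B i l * x l)"
    by (rule sum.swap)
  also have "\<dots> = (\<Sum>l<n. mat_mult n A B j l * x l)"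
    by (simp add: mat_mult_def sum_distrib_right)
  finally show "affmap n A 0 (affmap n B 0 x) j = affmap n (mat_mult n A B) 0 x j"
    by (simp add: affmap_def)
qed

lemma affmap_identity:
  assumes "\<And>i j. i < n \<Longrightarrow> j < n \<Longrightarrow> A i j = (if i = j then 1 else 0)" and "x \<in> Vn n"
  shows "affmap n A 0 x = x"
proof
  fix j
  show "affmap n A 0 x j = x j"
  proof (cases "j < n")
    case True
    have "(\<Sum>i<n. A j i * x i) = (\<Sum>i<n. if i = j then x i else 0)"
      using assms(1)[OF True] by (intro sum.cong) auto
    with True show ?thesis by (simp add: affmap_def)
  qed (use assms(2) in \<open>simp add: affmap_def Vn_def\<close>)
qed

lemma affmap_unit:
  assumes "i < n" "j < n"
  shows "affmap n A 0 (ind {j}) i = A i j"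
proof -
  have "(\<Sum>l<n. A i l * ind {j} l) = (\<Sum>l<n. if l = j then A i l else 0)"
    by (intro sum.cong) (auto simp: ind_def)
  with assms show ?thesis by (simp add: affmap_def)
qed

lemma GL_inj_on:
  assumes "GL n M"
  shows "inj_on (affmap n M v) (Vn n)"
proof (rule inj_onI)
  fix x y assume x: "x \<in> Vn n" and y: "y \<in> Vn n" and eq: "affmap n M v x = affmap n M v y"
  obtain N where N: "\<And>i j. i < n \<Longrightarrow> j < n \<Longrightarrow> mat_mult n N M i j = (if i = j then 1 else 0)"
    using assms unfolding GL_def by blast
  have id: "affmap n N 0 (affmap n M 0 z) = z" if "z \<in> Vn n" for z
    unfolding affmap_compose using N that by (rule affmap_identity)
  \<comment> \<open>Adding \<open>y\<close> to both arguments reduces injectivity to a trivial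
    kernel of the linear part.\<close>
  have "affmap n M v (x + y) = affmap n M v (y + y)"
    unfolding affmap_add_arg eq ..
  then have "affmap n M v 0 + affmap n M 0 (x + y) = affmap n M v 0 + affmap n M 0 0"
    by (metis affmap_add_arg add_0 bitfun_add_self)
  then have "affmap n M 0 (x + y) = affmap n M 0 0"
    by (rule add_left_imp_eq)
  then have "x + y = 0"
    using id[of "x + y"] id[of 0] x y by (metis Vn_0 Vn_add)
  then show "x = y" by simp
qed

lemma GL_image: "GL n M \<Longrightarrow> affmap n M v ` Vn n = Vn n"
  by (intro endo_inj_surj GL_inj_on) auto

lemma der_compose_affmap:
  "der u (\<lambda>x. f (affmap n M v x)) = (\<lambda>x. der (affmap n M 0 u) f (affmap n M v x))"
  by (simp add: der_def affmap_add_arg)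

text \<open>An invertible affine map permutes the points and its linear part the directions, so the
  quantifiers range over the same sets.\<close>

lemma deg_lt_compose_affmap:
  assumes "GL n M"
  shows "deg_lt n d (\<lambda>x. f (affmap n M v x)) \<longleftrightarrow> deg_lt n d f"
proof (induction d arbitrary: f)
  case 0
  have "(\<forall>x\<in>Vn n. f (affmap n M v x) = 0) \<longleftrightarrow> (\<forall>x\<in>affmap n M v ` Vn n. f x = 0)"
    by blast
  then show ?case by (simp only: deg_lt.simps GL_image[OF assms])
next
  case (Suc d)
  have "deg_lt n (Suc d) (\<lambda>x. f (affmap n M v x)) \<longleftrightarrow> (\<forall>u\<in>Vn n. deg_lt n d (der (affmap n M 0 u) f))"
    by (simp only: deg_lt.simps der_compose_affmap Suc.IH)
  also have "\<dots> \<longleftrightarrow> (\<forall>w\<in>affmap n M 0 ` Vn n. deg_lt n d (der w f))"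
    by blast
  also have "\<dots> \<longleftrightarrow> deg_lt n (Suc d) f"
    by (simp only: deg_lt.simps GL_image[OF assms])
  finally show ?case .
qed

text \<open>Over the two-element field, linear combinations are subset sums, so cardinality alone
  yields a vector outside the span of too few vectors.\<close>
lemma extend_independent:
  fixes b :: "'a \<Rightarrow> 'b \<Rightarrow> bit"
  assumes "finite J" "I \<subseteq> J" "card U = 2 ^ card J"
    and "b ` I \<subseteq> U" "\<And>S. S \<subseteq> I \<Longrightarrow> sum b S = 0 \<Longrightarrow> S = {}"
  shows "\<exists>b'. (\<forall>i\<in>I. b' i = b i) \<and> b' ` J \<subseteq> U \<and> (\<forall>S\<subseteq>J. sum b' S = 0 \<longrightarrow> S = {})"
  using assms(2,4,5)
proof (induction "card (J - I)" arbitrary: I b)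
  case 0
  then have "I = J" using assms(1) by auto
  with 0 show ?case by blast
next
  case (Suc m)
  have finI: "finite I" using Suc.prems assms(1) finite_subset by blast
  obtain x where x: "x \<in> J" "x \<notin> I"
    using Suc.hyps(2) by (metis card.empty Diff_eq_empty_iff nat.distinct(1) subsetI)
  have "card I < card J"
    using x Suc.prems(1) assms(1) by (intro psubset_card_mono) auto
  then have less: "card (Pow I) < card U"
    using finI by (simp add: card_Pow assms(3))
  have "card (sum b ` Pow I) \<le> card (Pow I)"
    using finI by (intro card_image_le) simp
  also note less
  finally have "\<not> U \<subseteq> sum b ` Pow I"
    using finI card_mono[of "sum b ` Pow I" U] by auto
  then obtain v where v: "v \<in> U" "v \<notin> sum b ` Pow I" by blast
  define c where "c = b(x := v)"
  have cb: "sum c S = sum b S" if "x \<notin> S" for S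
    using that by (intro sum.cong) (auto simp: c_def)
  have indep: "S = {}" if S: "S \<subseteq> insert x I" "sum c S = 0" for S
  proof (cases "x \<in> S")
    case True
    have "finite S" using S finI finite_subset by blast
    \<comment> \<open>If \<open>x\<close> occurred in a vanishing sum, \<open>v\<close> would be a
      subset sum of the earlier vectors.\<close>
    then have "sum c S = v + sum b (S - {x})"
      using True by (simp add: sum.remove[of S x c] cb) (simp add: c_def)
    with S(2) have "v = sum b (S - {x})" by simp
    with v(2) S(1) show ?thesis by blast
  next
    case False
    with S Suc.prems(3)[of S] cb[of S] show ?thesis by auto
  qed
  have "m = card (J - insert x I)"
    using Suc.hyps(2) x assms(1) by (metis Diff_insert card_Diff_singleton DiffI diff_Suc_1)
  moreover have "insert x I \<subseteq> J" "c ` insert x I \<subseteq> U"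
    using x v Suc.prems(1,2) by (auto simp: c_def)
  ultimately obtain b' where b': "\<forall>i\<in>insert x I. b' i = c i" "b' ` J \<subseteq> U" "\<forall>S\<subseteq>J. sum b' S = 0 \<longrightarrow> S = {}"
    using Suc.hyps(1)[of "insert x I" c] indep by blast
  moreover have "\<forall>i\<in>I. b' i = b i"
    using b'(1) x(2) by (auto simp: c_def)
  ultimately show ?case by blast
qed

text \<open>Sets of columns with zero sum correspond to kernel vectors. An injective linear map of
  the finite space is onto, and preimages of the unit vectors are the columns of the
  inverse.\<close>

lemma GL_of_independent_columns:
  fixes b :: "nat \<Rightarrow> nat \<Rightarrow> bit"
  assumes b: "\<And>i. i < n \<Longrightarrow> b i \<in> Vn n" and indep: "\<And>S. S \<subseteq> {..<n} \<Longrightarrow> sum b S = 0 \<Longrightarrow> S = {}"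
  shows "GL n (\<lambda>j i. b i j)"
proof -
  define M where "M = (\<lambda>j i. b i j)"
  have ker: "x = 0" if x: "x \<in> Vn n" "affmap n M 0 x = 0" for x
  proof -
    define S where "S = {i. i < n \<and> x i = 1}"
    have S: "S \<subseteq> {..<n}" by (auto simp: S_def)
    have "sum b S j = affmap n M 0 x j" for j
    proof (cases "j < n")
      case True
      have "sum b S j = (\<Sum>i\<in>{..<n}. if i \<in> S then b i j else 0)"
        using S by (simp add: sum_fun_apply sum.inter_restrict[symmetric] Int_absorb1)
      also have "\<dots> = (\<Sum>i<n. M j i * x i)"
        by (intro sum.cong) (auto simp: S_def M_def)
      finally show ?thesis using True by (simp add: affmap_def)
    next
      case False
      then show ?thesis
        using b S by (auto simp: affmap_def sum_fun_apply Vn_def intro!: sum.neutral)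
    qed
    then have "sum b S = 0"
      using x(2) by (metis ext)
    then have "S = {}" using indep S by blast
    with Vn_eq_ind[OF x(1)] have "x = ind {}"
      unfolding S_def by argo
    then show ?thesis by (simp add: ind_def fun_eq_iff)
  qed
  have inj: "inj_on (affmap n M 0) (Vn n)"
  proof (rule inj_onI)
    fix x y assume xy: "x \<in> Vn n" "y \<in> Vn n" "affmap n M 0 x = affmap n M 0 y"
    have "affmap n M 0 (x + y) = 0"
      unfolding affmap_add_arg xy(3) by (rule bitfun_add_self)
    then have "x + y = 0"
      by (rule ker[OF Vn_add[OF xy(1,2)]])
    then show "x = y" by simp
  qed
  then have "affmap n M 0 ` Vn n = Vn n"
    by (intro endo_inj_surj) auto
  then have "\<forall>i. \<exists>x. i < n \<longrightarrow> x \<in> Vn n \<and> affmap n M 0 x = ind {i}"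
    by (metis (no_types, lifting) empty_subsetI image_iff ind_in_Vn insert_subset lessThan_iff)
  then obtain g where g: "\<And>i. i < n \<Longrightarrow> g i \<in> Vn n" "\<And>i. i < n \<Longrightarrow> affmap n M 0 (g i) = ind {i}"
    by metis
  define N where "N = (\<lambda>j i. g i j)"
  have MN: "mat_mult n M N i j = (if i = j then 1 else 0)" if "i < n" "j < n" for i j
  proof -
    have "mat_mult n M N i j = affmap n M 0 (g j) i"
      using that by (simp add: mat_mult_def N_def affmap_def)
    then show ?thesis using g(2)[OF that(2)] by (simp add: ind_def)
  qed
  have NM: "mat_mult n N M i j = (if i = j then 1 else 0)" if ij: "i < n" "j < n" for i j
  proof -
    define y where "y = affmap n N 0 (affmap n M 0 (ind {j}))"
    \<comment> \<open>The right inverse \<open>N\<close> is also a left inverse: \<open>M\<close>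
      can be cancelled by injectivity.\<close>
    have "affmap n M 0 y = affmap n M 0 (ind {j})"
      unfolding y_def affmap_compose[of n M N] using MN by (rule affmap_identity) auto
    then have "y = ind {j}"
      using inj ij by (auto simp: inj_on_def y_def)
    moreover have "y i = mat_mult n N M i j"
      unfolding y_def affmap_compose using ij by (rule affmap_unit)
    ultimately show ?thesis by (cases "i = j") (simp_all add: ind_def)
  qed
  show ?thesis
    unfolding GL_def M_def[symmetric] using MN NM by blast
qed

section \<open>The monomial normal form\<close>

text \<open>Above size \<open>k\<close> the degree bound applies. At size \<open>k\<close>,
  \<open>S\<close> contains some \<open>j \<ge> k\<close>; removing it leaves a coefficient of the
  derivative along \<open>ind {j}\<close>, whose degree is too small.\<close>

lemma moebius_eq_0_if_directions_degenerate:
  assumes "deg_lt n (Suc k) g" and "\<And>j. k \<le> j \<Longrightarrow> j < n \<Longrightarrow> deg_lt n (k - 1) (der (ind {j}) g)"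
    and S: "S \<subseteq> {..<n}" "k \<le> card S" "S \<noteq> {..<k}"
  shows "moebius g S = 0"
proof (cases "card S = k")
  case True
  have fin: "finite S" using S finite_subset by blast
  have "\<not> S \<subseteq> {..<k}"
    using True S(3) card_subset_eq[of "{..<k}" S] by auto
  then obtain j where j: "j \<in> S" "k \<le> j" by (meson lessThan_iff not_less subsetI)
  have "moebius g S = moebius (der (ind {j}) g) (S - {j})"
    using moebius_insert[of "S - {j}" j g] j fin by (simp add: insert_absorb)
  also have "\<dots> = 0"
    using assms(2)[of j] j S(1) fin True by (intro moebius_eq_0_if_deg_lt[of n "k - 1"]) auto
  finally show ?thesis .
next
  case False
  with assms show ?thesis by (intro moebius_eq_0_if_deg_lt[of n "Suc k"]) auto
qed

lemma der_monomial_eq_0: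
  assumes "T \<inter> S = {}"
  shows "der (ind T) (\<lambda>x. \<Prod>i\<in>S. x i) = 0"
proof
  fix x
  have "(\<Prod>i\<in>S. (x + ind T) i) = (\<Prod>i\<in>S. x i)"
    using assms by (intro prod.cong) (auto simp: ind_def)
  then show "der (ind T) (\<lambda>x. \<Prod>i\<in>S. x i) x = 0 x"
    by (simp only: der_def) simp
qed

lemma moebius_monomial: "finite S \<Longrightarrow> moebius (\<lambda>x. \<Prod>i\<in>S. x i) S = 1"
proof -
  assume fin: "finite S"
  have "moebius (\<lambda>x. \<Prod>i\<in>S. x i) S = (\<Sum>T\<in>Pow S. if T = S then 1 else 0)"
    unfolding moebius_def using fin by (intro sum.cong) (auto simp: prod_ind)
  with fin show ?thesis by simp
qed

lemma affeq_deg_monomial_if_card_radical: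
  assumes k: "1 \<le> k" "k \<le> n" and f: "deg_lt n (Suc k) f" "\<not> deg_lt n k f"
    and card: "card (radical n k f) * 2 ^ k = 2 ^ n"
  shows "affeq_deg n (k - 1) f (\<lambda>x. \<Prod>i<k. x i)"
proof -
  have "card (radical n k f) * 2 ^ k = 2 ^ (n - k) * 2 ^ k"
    using card k by (simp flip: power_add)
  then have "card (radical n k f) = 2 ^ card {k..<n}" by simp
  \<comment> \<open>A basis of the radical, indexed by \<open>{k..<n}\<close> so that the first
    \<open>k\<close> coordinates are left for the monomial.\<close>
  then obtain b where b: "b ` {k..<n} \<subseteq> radical n k f" "\<And>S. S \<subseteq> {k..<n} \<Longrightarrow> sum b S = 0 \<Longrightarrow> S = {}"
    using extend_independent[of "{k..<n}" "{}" "radical n k f"] by auto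
  have "\<exists>c. (\<forall>i\<in>{k..<n}. c i = b i) \<and> c ` {..<n} \<subseteq> Vn n \<and> (\<forall>S\<subseteq>{..<n}. sum c S = 0 \<longrightarrow> S = {})"
  proof (rule extend_independent)
    show "b ` {k..<n} \<subseteq> Vn n" using b(1) radical_subset by blast
    show "S = {}" if "S \<subseteq> {k..<n}" "sum b S = 0" for S using b(2) that .
  qed (auto simp: card_Vn)
  then obtain c where c: "\<forall>i\<in>{k..<n}. c i = b i" "c ` {..<n} \<subseteq> Vn n"
      "\<forall>S\<subseteq>{..<n}. sum c S = 0 \<longrightarrow> S = {}"
    by (elim exE conjE)
  define M where "M = (\<lambda>j i. c i j)"
  have GL: "GL n M"
    unfolding M_def using c(2,3) by (intro GL_of_independent_columns) blast+
  define h where "h = (\<lambda>x. f (affmap n M 0 x))"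
  define m where "m = (\<lambda>x :: nat \<Rightarrow> bit. \<Prod>i<k. x i)"
  have h: "deg_lt n (Suc k) h" "\<not> deg_lt n k h"
    unfolding h_def using f deg_lt_compose_affmap[OF GL] by blast+
  have dh: "deg_lt n (k - 1) (der (ind {j}) h)" if "k \<le> j" "j < n" for j
  proof -
    have "affmap n M 0 (ind {j}) i = c j i" for i
      using that affmap_unit[of i n j M] c(2) by (cases "i < n") (auto simp: M_def affmap_def Vn_def)
    then have "affmap n M 0 (ind {j}) = b j"
      using bspec[OF c(1), of j] that by (simp add: fun_eq_iff)
    moreover have "b j \<in> radical n k f"
      using b(1) that by auto
    ultimately have "deg_lt n (k - 1) (der (affmap n M 0 (ind {j})) f)"
      by (simp add: radical_def)
    then show ?thesis
      unfolding h_def der_compose_affmap using deg_lt_compose_affmap[OF GL] by blast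
  qed
  have m: "deg_lt n (Suc k) m"
    unfolding m_def using deg_lt_monomial[of "{..<k}" n] by (simp only: card_lessThan finite_lessThan)
  have dm: "der (ind {j}) m = 0" if "k \<le> j" for j
    unfolding m_def using that by (intro der_monomial_eq_0) auto
  \<comment> \<open>Otherwise every coefficient of size at least \<open>k\<close> would vanish and
    \<open>h\<close> would have degree below \<open>k\<close>.\<close>
  have "moebius h {..<k} = 1"
  proof (rule ccontr)
    assume *: "moebius h {..<k} \<noteq> 1"
    have "moebius h S = 0" if "S \<subseteq> {..<n}" "k - 1 < card S" for S
      using moebius_eq_0_if_directions_degenerate[OF h(1) dh, of S] that * k
      by (cases "S = {..<k}") auto
    then have "deg_lt n (Suc (k - 1)) h"
      unfolding deg_le_iff_deg_lt[symmetric] deg_le_iff_moebius by blast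
    with h(2) k show False by simp
  qed
  moreover have "moebius m {..<k} = 1"
    unfolding m_def by (rule moebius_monomial) simp
  moreover have "moebius (m + h) S = moebius m S + moebius h S" for S
    by (simp add: moebius_def sum.distrib)
  moreover have "moebius (m + h) S = 0" if "S \<subseteq> {..<n}" "k - 1 < card S" "S \<noteq> {..<k}" for S
  proof (rule moebius_eq_0_if_directions_degenerate[of n k])
    show "deg_lt n (Suc k) (m + h)" using m h(1) by (rule deg_lt_add)
    show "deg_lt n (k - 1) (der (ind {j}) (m + h))" if "k \<le> j" "j < n" for j
      unfolding der_add_fun dm[OF that(1)] add_0 by (rule dh[OF that])
  qed (use that k in auto)
  \<comment> \<open>At \<open>S = {..<k}\<close> the two coefficients are both 1 and cancel.\<close>
  ultimately have "moebius (m + h) S = 0" if "S \<subseteq> {..<n}" "k - 1 < card S" for S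
    using that by (cases "S = {..<k}") auto
  then have "deg n (m + h) \<le> k - 1"
    unfolding deg_le_iff_moebius by blast
  moreover have "affeq n f h"
    unfolding affeq_def h_def using GL Vn_0 by blast
  ultimately show ?thesis
    unfolding affeq_deg_def m_def plus_fun_def by blast
qed

text \<open>The monomial is constant along sums of the last \<open>n - k\<close> unit vectors. Their
  images under the linear part are \<open>2 ^ (n - k)\<close> vectors of the radical, the maximum
  that \<open>card_radical_le\<close> permits.\<close>

lemma card_radical_if_affeq_deg_monomial:
  assumes k: "1 \<le> k" "k \<le> n" and f: "\<not> deg_lt n k f"
    and "affeq_deg n (k - 1) f (\<lambda>x. \<Prod>i<k. x i)"
  shows "card (radical n k f) * 2 ^ k = 2 ^ n"
proof -
  define m where "m = (\<lambda>x :: nat \<Rightarrow> bit. \<Prod>i<k. x i)"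
  obtain h M v where M: "GL n M" and h: "\<And>x. x \<in> Vn n \<Longrightarrow> h x = f (affmap n M v x)"
    and deg: "deg n (\<lambda>x. m x + h x) \<le> k - 1"
    using assms(4) unfolding affeq_deg_def affeq_def m_def by blast
  \<comment> \<open>\<open>h\<close> is known only on \<open>Vn n\<close>; \<open>h'\<close> is the
    composition everywhere, so its derivatives can be rewritten as functions.\<close>
  define h' where "h' = (\<lambda>x. f (affmap n M v x))"
  have "deg_lt n (Suc (k - 1)) (\<lambda>x. m x + h x)"
    using deg unfolding deg_le_iff_deg_lt .
  then have "deg_lt n (Suc (k - 1)) (m + h')"
    by (rule deg_lt_cong[THEN iffD1, rotated]) (simp add: h h'_def)
  then have mh: "deg_lt n (k - 1) (der u (m + h'))" if "u \<in> Vn n" for u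
    using that by simp
  have "affmap n M 0 (ind T) \<in> radical n k f" if T: "T \<subseteq> {k..<n}" for T
  proof -
    have "der (ind T) m = 0"
      unfolding m_def using T by (intro der_monomial_eq_0) force
    then have "der (ind T) (m + h') = (\<lambda>x. der (affmap n M 0 (ind T)) f (affmap n M v x))"
      by (simp only: der_add_fun add_0 h'_def der_compose_affmap)
    moreover have "ind T \<in> Vn n" using T by auto
    ultimately have "deg_lt n (k - 1) (der (affmap n M 0 (ind T)) f)"
      using mh deg_lt_compose_affmap[OF M] by metis
    then show ?thesis by (simp add: radical_def)
  qed
  then have "affmap n M 0 ` ind ` Pow {k..<n} \<subseteq> radical n k f"
    by blast
  moreover have "card (affmap n M 0 ` ind ` Pow {k..<n}) = 2 ^ (n - k)"
  proof -
    have "ind ` Pow {k..<n} \<subseteq> Vn n" by force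
    then have "inj_on (affmap n M 0) (ind ` Pow {k..<n})"
      by (rule inj_on_subset[OF GL_inj_on[OF M]])
    then show ?thesis by (simp add: card_image inj_ind card_Pow)
  qed
  ultimately have "2 ^ (n - k) \<le> card (radical n k f)"
    by (metis card_mono finite_radical)
  then have "2 ^ (n - k) * 2 ^ k \<le> card (radical n k f) * 2 ^ k"
    by (rule mult_right_mono) simp
  moreover have "2 ^ (n - k) * 2 ^ k = (2 :: nat) ^ n"
    using k by (simp flip: power_add)
  ultimately show ?thesis
    using card_radical_le[OF f] by simp
qed

theorem theorem2:
  fixes n k :: nat and f :: "(nat \<Rightarrow> bit) \<Rightarrow> bit"
  assumes "1 \<le> k" and "k \<le> n" and "deg n f = k"
  shows "(\<Prod>i=1..k. 1 - 1 / (2::real) ^ i) \<le> dt n k f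
       \<and> dt n k f \<le> 1 / 2 * (1 - 1 / (2::real) ^ n) ^ (k - 1)
       \<and> (dt n k f = (\<Prod>i=1..k. 1 - 1 / (2::real) ^ i)
            \<longleftrightarrow> affeq_deg n (k - 1) f (\<lambda>x. \<Prod>i<k. x i))"
proof -
  \<comment> \<open>As \<open>k\<close> is positive, \<open>deg_lt n k f\<close> means degree at
    most \<open>k - 1\<close>.\<close>
  have f: "deg_lt n (Suc k) f" "\<not> deg_lt n k f"
    using assms deg_le_iff_deg_lt[of n f k] deg_le_iff_deg_lt[of n f "k - 1"]
    by (auto simp del: deg_lt.simps)
  have "card (radical n k f) * 2 ^ k = 2 ^ n \<longleftrightarrow> affeq_deg n (k - 1) f (\<lambda>x. \<Prod>i<k. x i)"
    using affeq_deg_monomial_if_card_radical card_radical_if_affeq_deg_monomial assms(1,2) f by blast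
  moreover have "dt n k f \<le> 1 / 2 * (1 - 1 / (2::real) ^ n) ^ (k - 1)"
    using der_avg_upper[of n "k - 1" f] f(1) assms(1)
    by (simp add: dt_eq_der_avg del: deg_lt.simps der_avg.simps)
  ultimately show ?thesis
    using der_avg_lower[OF f] unfolding dt_eq_der_avg by blast
qed

end
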